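(* Let $(Y,\tau)$ be a topological space and $(Z,\mathcal{U})$ a uniform space. A topology $\mathbb{T}$ on $\mathcal{O}_Z(Y)$ is admissible if and only if its dual topology $\mathfrak{T}(\mathbb{T})$ on $EC(Y,Z)$ is admissible.
   Context: Uniform spaces $(Z,\mathcal{U})$ are given in the usual sense by a family $\mathcal{U}$ of entourages on a non-empty set $Z$. For $U\in\mathcal{U}$ and $z\in Z$, $U[z]=\{w\in Z : (z,w)\in U\}$. Equi-continuity: a function $f:(X,\tau)\to(Z,\mathcal{U})$ from a topological space to a uniform space is equi-continuous at $x\in X$ if for each $U\in\mathcal{U}$ there is an open neighbourhood $V$ of $x$ with $f(V)\subseteq U[f(x)]$; it is equi-continuous if this holds at all $x\in X$. $EC(Y,Z)$ is the set of all equi-continuous functions from $Y$ to $Z$. The set $\mathcal{O}_Z(Y)$: for each $U\in\mathcal{U}$, $f\in EC(Y,Z)$, $y\in Y$ fix an open neighbourhood of $y$ in $Y$, denoted $U(f,y)$, with $f(U(f,y))\subseteq U[f(y)]$ (it exists by equi-continuity). Put $\mathcal{O}_Z(Y)=\{U(f,y) : U\in\mathcal{U}, f\in EC(Y,Z), y\in Y\}$. Dual topology: for $\mathbb{H}\subseteq\mathcal{O}_Z(Y)$ and $U\in\mathcal{U}$ let $(\mathbb{H},U)=\{f\in EC(Y,Z) : U(f,y)\in\mathbb{H}\text{ for each }y\in Y\}$. For a topology $\mathbb{T}$ on $\mathcal{O}_Z(Y)$, its dual $\mathfrak{T}(\mathbb{T})$ is the topology on $EC(Y,Z)$ generated by the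 subbasis $\{(\mathbb{H},U) : \mathbb{H}\in\mathbb{T}, U\in\mathcal{U}\}$. Associated maps: for a topological space $X$, maps $g:X\times Y\to Z$ and $g^*:X\to EC(Y,Z)$ are associated if $g^*(x)(y)=g(x,y)$ for all $x\in X$, $y\in Y$. For associated $g,g^*$ define the multifunction $\overline{g}:X\times\mathcal{U}\to\mathcal{O}_Z(Y)$ by $\overline{g}(x,U)=\{U(g^*(x),y) : y\in Y\}$. Upper semi continuity: a multifunction $F:X\to W$ between topological spaces is upper semi continuous if for each $x\in X$ and each open $V\subseteq W$ with $F(x)\subseteq V$ there is an open $O\ni x$ with $F(x')\subseteq V$ for all $x'\in O$. A multifunction $M:X\times\mathcal{U}\to\mathcal{O}_Z(Y)$ is upper semi continuous with respect to the first variable if for every fixed $U\in\mathcal{U}$ the multifunction $M_U:X\to\mathcal{O}_Z(Y)$, $M_U(x)=M(x,U)$, is upper semi continuous. Admissible: a topology $\mathfrak{T}$ on $EC(Y,Z)$ is admissible if the evaluation map $e:EC(Y,Z)\times Y\to Z$, $e(f,y)=f(y)$, is equi-continuous (with the product topology on $EC(Y,Z)\times Y$). A topology $\mathbb{T}$ on $\mathcal{O}_Z(Y)$ is admissible if for each topological space $(X,\mu)$ and every map $g^*:X\to EC(Y,Z)$, upper semi continuity with respect to the first variable of $\overline{g}:X\times\mathcal{U}\to(\mathcal{O}_Z(Y),\mathbb{T})$ implies equi-continuity of the associated map $g:X\times Y\to Z$. *)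

theory Defs
  imports "HOL-Analysis.Product_Topology" "HOL-Library.FuncSet"
begin

text \<open>The uniform space \<open>Z\<close> is a type of class \<^class>\<open>uniform_space\<close>; its family of entourages is the
  family of members of the filter \<^const>\<open>uniformity\<close>, and \<open>U[z]\<close> is \<open>U `` {z}\<close>.
  The space \<open>Y\<close> is an abstract topology, with carrier \<open>topspace Y\<close>.\<close>

definition entourages :: "('z::uniform_space \<times> 'z) set set" where
  "entourages = {U. \<forall>\<^sub>F p in uniformity. p \<in> U}"

definition equi_continuous_at :: "'a topology \<Rightarrow> ('a \<Rightarrow> 'z::uniform_space) \<Rightarrow> 'a \<Rightarrow> bool" where
  "equi_continuous_at X f x \<longleftrightarrow>
     (\<forall>U\<in>entourages. \<exists>V. openin X V \<and> x \<in> V \<and> f ` V \<subseteq> U `` {f x})"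

definition equi_continuous :: "'a topology \<Rightarrow> ('a \<Rightarrow> 'z::uniform_space) \<Rightarrow> bool" where
  "equi_continuous X f \<longleftrightarrow> (\<forall>x\<in>topspace X. equi_continuous_at X f x)"

text \<open>Functions on the carrier of \<open>Y\<close> are represented by their extensional representatives,
  so that equality in \<open>EC Y\<close> is equality on \<open>topspace Y\<close>.\<close>

definition EC :: "'y topology \<Rightarrow> ('y \<Rightarrow> 'z::uniform_space) set" where
  "EC Y = {f \<in> extensional (topspace Y). equi_continuous Y f}"

text \<open>\<open>N U f y\<close> is the fixed open neighbourhood written \<open>U(f,y)\<close>. The choice \<open>N\<close> is an explicit
  parameter of everything that depends on it.\<close>

definition nbhd_choice ::
    "'y topology \<Rightarrow> (('z::uniform_space \<times> 'z) set \<Rightarrow> ('y \<Rightarrow> 'z) \<Rightarrow> 'y \<Rightarrow> 'y set) \<Rightarrow> bool" where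
  "nbhd_choice Y N \<longleftrightarrow>
     (\<forall>U\<in>entourages. \<forall>f\<in>EC Y. \<forall>y\<in>topspace Y.
        openin Y (N U f y) \<and> y \<in> N U f y \<and> f ` N U f y \<subseteq> U `` {f y})"

definition OZ ::
    "'y topology \<Rightarrow> (('z::uniform_space \<times> 'z) set \<Rightarrow> ('y \<Rightarrow> 'z) \<Rightarrow> 'y \<Rightarrow> 'y set) \<Rightarrow> 'y set set" where
  "OZ Y N = {N U f y | U f y. U \<in> entourages \<and> f \<in> EC Y \<and> y \<in> topspace Y}"

definition dual_subbasic ::
    "'y topology \<Rightarrow> (('z::uniform_space \<times> 'z) set \<Rightarrow> ('y \<Rightarrow> 'z) \<Rightarrow> 'y \<Rightarrow> 'y set)
      \<Rightarrow> 'y set set \<Rightarrow> ('z \<times> 'z) set \<Rightarrow> ('y \<Rightarrow> 'z) set" where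
  "dual_subbasic Y N H U = {f \<in> EC Y. \<forall>y\<in>topspace Y. N U f y \<in> H}"

definition dual_topology ::
    "'y topology \<Rightarrow> (('z::uniform_space \<times> 'z) set \<Rightarrow> ('y \<Rightarrow> 'z) \<Rightarrow> 'y \<Rightarrow> 'y set)
      \<Rightarrow> 'y set topology \<Rightarrow> ('y \<Rightarrow> 'z) topology" where
  "dual_topology Y N T =
     topology_generated_by {dual_subbasic Y N H U | H U. openin T H \<and> U \<in> entourages}"

definition associated ::
    "'x topology \<Rightarrow> 'y topology \<Rightarrow> ('x \<times> 'y \<Rightarrow> 'z) \<Rightarrow> ('x \<Rightarrow> 'y \<Rightarrow> 'z) \<Rightarrow> bool" where
  "associated X Y g gs \<longleftrightarrow> (\<forall>x\<in>topspace X. \<forall>y\<in>topspace Y. gs x y = g (x, y))"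

definition assoc_multi ::
    "'y topology \<Rightarrow> (('z::uniform_space \<times> 'z) set \<Rightarrow> ('y \<Rightarrow> 'z) \<Rightarrow> 'y \<Rightarrow> 'y set)
      \<Rightarrow> ('x \<Rightarrow> 'y \<Rightarrow> 'z) \<Rightarrow> 'x \<times> ('z \<times> 'z) set \<Rightarrow> 'y set set" where
  "assoc_multi Y N gs = (\<lambda>(x, U). {N U (gs x) y | y. y \<in> topspace Y})"

text \<open>A multifunction from \<open>X\<close> to \<open>W\<close> is a function from points of \<open>X\<close> to subsets of \<open>W\<close>.\<close>

definition upper_semicontinuous ::
    "'x topology \<Rightarrow> 'w topology \<Rightarrow> ('x \<Rightarrow> 'w set) \<Rightarrow> bool" where
  "upper_semicontinuous X W F \<longleftrightarrow>
     (\<forall>x\<in>topspace X. F x \<subseteq> topspace W) \<and>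
     (\<forall>x\<in>topspace X. \<forall>V. openin W V \<and> F x \<subseteq> V \<longrightarrow>
        (\<exists>G. openin X G \<and> x \<in> G \<and> (\<forall>x'\<in>G. F x' \<subseteq> V)))"

definition upper_semicontinuous_fst ::
    "'x topology \<Rightarrow> 'w topology \<Rightarrow> ('x \<times> ('z::uniform_space \<times> 'z) set \<Rightarrow> 'w set) \<Rightarrow> bool" where
  "upper_semicontinuous_fst X W M \<longleftrightarrow>
     (\<forall>U\<in>entourages. upper_semicontinuous X W (\<lambda>x. M (x, U)))"

definition EC_admissible :: "'y topology \<Rightarrow> ('y \<Rightarrow> 'z::uniform_space) topology \<Rightarrow> bool" where
  "EC_admissible Y S \<longleftrightarrow> equi_continuous (prod_topology S Y) (\<lambda>(f, y). f y)"

text \<open>HOL cannot quantify over types inside a formula, so the type \<open>'x\<close> carrying the test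
  spaces \<open>X\<close> is a parameter: \<open>X\<close> ranges over all topological spaces whose carrier is a subset
  of \<open>'x\<close>.\<close>

definition OZ_admissible ::
    "'x itself \<Rightarrow> 'y topology \<Rightarrow> (('z::uniform_space \<times> 'z) set \<Rightarrow> ('y \<Rightarrow> 'z) \<Rightarrow> 'y \<Rightarrow> 'y set)
      \<Rightarrow> 'y set topology \<Rightarrow> bool" where
  "OZ_admissible _ Y N T \<longleftrightarrow>
     (\<forall>(X :: 'x topology) gs g.
        gs ` topspace X \<subseteq> EC Y \<and> associated X Y g gs \<and>
        upper_semicontinuous_fst X T (assoc_multi Y N gs)
        \<longrightarrow> equi_continuous (prod_topology X Y) g)"

lemma nbhd_choice_exists: "\<exists>N. nbhd_choice (Y :: 'y topology)
    (N :: ('z::uniform_space \<times> 'z) set \<Rightarrow> ('y \<Rightarrow> 'z) \<Rightarrow> 'y \<Rightarrow> 'y set)"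
proof -
  have "\<exists>V. openin Y V \<and> y \<in> V \<and> f ` V \<subseteq> U `` {f y}"
    if "U \<in> entourages" "f \<in> EC Y" "y \<in> topspace Y"
    for U :: "('z \<times> 'z) set" and f y
    using that by (auto simp: EC_def equi_continuous_def equi_continuous_at_def)
  then show ?thesis
    unfolding nbhd_choice_def
    by (intro exI[of _ "\<lambda>U f y. SOME V. openin Y V \<and> y \<in> V \<and> f ` V \<subseteq> U `` {f y}"])
       (metis (mono_tags, lifting) someI_ex)
qed

lemma topspace_dual_topology:
  assumes "topspace T = OZ Y N"
  shows "topspace (dual_topology Y N T) = EC Y"
proof -
  have U: "UNIV \<in> entourages" by (simp add: entourages_def)
  have "f \<in> dual_subbasic Y N (topspace T) UNIV" if "f \<in> EC Y" for f
    using that U assms by (auto simp: dual_subbasic_def OZ_def)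
  with U show ?thesis
    unfolding dual_topology_def topology_generated_by_topspace
    by (auto simp: dual_subbasic_def)
qed

end

theory Submission imports Defs begin

text \<open>For \<open>g\<^sup>* : X \<rightarrow> EC(Y,Z)\<close>, the preimage of the subbasic set \<open>(H,U)\<close> of the dual topology is
  the set of points \<open>x\<close> with \<open>{U(g\<^sup>*(x),y) : y \<in> Y} \<subseteq> H\<close>. Hence the associated multifunction is
  upper semi continuous in the first variable iff \<open>g\<^sup>*\<close> is continuous into the dual topology.
  If evaluation \<open>e\<close> is equi-continuous, so is \<open>g = e \<circ> (g\<^sup>* \<times> id)\<close>; conversely, \<open>e\<close> is the map
  associated with the identity of \<open>EC(Y,Z)\<close>.\<close>

lemma equi_continuous_compose:
  fixes f :: "'w \<Rightarrow> 'z::uniform_space"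
  assumes "continuous_map X W h" "equi_continuous W f"
  shows "equi_continuous X (f \<circ> h)"
  unfolding equi_continuous_def equi_continuous_at_def
proof (intro ballI)
  fix x and U :: "('z \<times> 'z) set"
  assume x: "x \<in> topspace X" and U: "U \<in> entourages"
  have "h x \<in> topspace W"
    using assms(1) x by (auto simp: continuous_map_def)
  then obtain V where V: "openin W V" "h x \<in> V" "f ` V \<subseteq> U `` {f (h x)}"
    using assms(2) U unfolding equi_continuous_def equi_continuous_at_def by blast
  have "openin X {x \<in> topspace X. h x \<in> V}"
    using assms(1) V(1) by (rule openin_continuous_map_preimage)
  moreover have "(f \<circ> h) ` {x \<in> topspace X. h x \<in> V} \<subseteq> U `` {(f \<circ> h) x}"
    using V(3) by auto
  ultimately show "\<exists>V. openin X V \<and> x \<in> V \<and> (f \<circ> h) ` V \<subseteq> U `` {(f \<circ> h) x}"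
    using x V(2) by blast
qed

text \<open>Open sets lie inside the carrier, so values elsewhere never matter. This is needed
  because \<open>associated\<close> fixes \<open>g\<close> only on the carriers of \<open>X\<close>
  and \<open>Y\<close>.\<close>

lemma equi_continuous_eq:
  fixes f g :: "'a \<Rightarrow> 'z::uniform_space"
  assumes "\<And>x. x \<in> topspace X \<Longrightarrow> f x = g x" "equi_continuous X f"
  shows "equi_continuous X g"
  unfolding equi_continuous_def equi_continuous_at_def
proof (intro ballI)
  fix x and U :: "('z \<times> 'z) set"
  assume x: "x \<in> topspace X" and U: "U \<in> entourages"
  obtain V where V: "openin X V" "x \<in> V" "f ` V \<subseteq> U `` {f x}"
    using assms(2) x U unfolding equi_continuous_def equi_continuous_at_def by blast
  have "g ` V = f ` V"
    using assms(1) openin_subset[OF V(1)] by (intro image_cong) auto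
  then show "\<exists>V. openin X V \<and> x \<in> V \<and> g ` V \<subseteq> U `` {g x}"
    using V assms(1)[OF x] by (intro exI[of _ V]) simp
qed

text \<open>For fixed \<open>V\<close> the pointwise condition makes the set of \<open>x\<close>
  with \<open>F x \<subseteq> V\<close> a neighbourhood of each of its points, hence open. In this
  form it can be compared with continuity.\<close>

lemma upper_semicontinuous_iff_openin:
  "upper_semicontinuous X W F \<longleftrightarrow>
     (\<forall>x\<in>topspace X. F x \<subseteq> topspace W) \<and>
     (\<forall>V. openin W V \<longrightarrow> openin X {x \<in> topspace X. F x \<subseteq> V})"
proof -
  have eq: "(\<forall>x\<in>topspace X. F x \<subseteq> V \<longrightarrow> (\<exists>G. openin X G \<and> x \<in> G \<and> (\<forall>x'\<in>G. F x' \<subseteq> V)))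
      \<longleftrightarrow> openin X {x \<in> topspace X. F x \<subseteq> V}"
    (is "?L = openin X ?S") for V
  proof
    assume ?L
    have "\<exists>G. openin X G \<and> x \<in> G \<and> G \<subseteq> ?S" if "x \<in> ?S" for x
    proof -
      have "x \<in> topspace X" "F x \<subseteq> V"
        using that by simp_all
      with \<open>?L\<close> obtain G where "openin X G" "x \<in> G" "\<forall>x'\<in>G. F x' \<subseteq> V"
        by meson
      then show ?thesis
        using openin_subset[of X G] by (intro exI[of _ G]) auto
    qed
    then show "openin X ?S"
      by (subst openin_subopen) (rule ballI)
  next
    assume "openin X ?S"
    then show ?L
      by (intro ballI impI exI[of _ ?S]) simp
  qed
  show ?thesis
    \<comment> \<open>After this rewriting the two sides differ only in the order of the quantifiers
      over \<open>x\<close> and \<open>V\<close>.\<close>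
    unfolding upper_semicontinuous_def eq[symmetric]
    by (intro conj_cong refl iffI ballI allI impI) simp_all
qed

lemma upper_semicontinuous_fst_assoc_multi_iff:
  assumes "topspace T = OZ Y N" "gs ` topspace X \<subseteq> EC Y"
  shows "upper_semicontinuous_fst X T (assoc_multi Y N gs) \<longleftrightarrow>
         continuous_map X (dual_topology Y N T) gs"
proof -
  have preimage: "gs -` dual_subbasic Y N H U \<inter> topspace X =
      {x \<in> topspace X. assoc_multi Y N gs (x, U) \<subseteq> H}" for H U
    using assms(2) by (auto simp: dual_subbasic_def assoc_multi_def)
  \<comment> \<open>The carrier clause of \<open>upper_semicontinuous\<close> thus holds
    automatically, and only the openness of the preimages remains.\<close>
  have "assoc_multi Y N gs (x, U) \<subseteq> topspace T"
    if "x \<in> topspace X" "U \<in> entourages" for x U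
  proof -
    have "gs x \<in> EC Y"
      using that(1) assms(2) by auto
    then have "N U (gs x) y \<in> OZ Y N" if "y \<in> topspace Y" for y
      using that \<open>U \<in> entourages\<close> unfolding OZ_def by blast
    then show ?thesis
      by (auto simp: assoc_multi_def assms(1))
  qed
  then have "upper_semicontinuous_fst X T (assoc_multi Y N gs) \<longleftrightarrow>
      (\<forall>U\<in>entourages. \<forall>H. openin T H \<longrightarrow>
         openin X (gs -` dual_subbasic Y N H U \<inter> topspace X))"
    by (simp add: upper_semicontinuous_fst_def upper_semicontinuous_iff_openin preimage)
  \<comment> \<open>Continuity into a generated topology can be tested on the subbasis, provided
    that \<open>gs\<close> maps into its union, which is \<open>EC Y\<close>.\<close>
  moreover have "gs \<in> topspace X \<rightarrow> \<Union>{dual_subbasic Y N H U | H U. openin T H \<and> U \<in> entourages}"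
    using assms(2) topspace_dual_topology[OF assms(1)]
    by (auto simp: dual_topology_def)
  ultimately show ?thesis
    by (auto simp: dual_topology_def continuous_on_generated_topo_iff)
qed

lemma OZ_admissible_if_EC_admissible:
  assumes T: "topspace T = OZ Y N" and adm: "EC_admissible Y (dual_topology Y N T)"
  shows "OZ_admissible TYPE('x) Y N T"
  unfolding OZ_admissible_def
proof (intro allI impI, elim conjE)
  fix X :: "'x topology" and gs g
  assume gs: "gs ` topspace X \<subseteq> EC Y" and g: "associated X Y g gs"
    and usc: "upper_semicontinuous_fst X T (assoc_multi Y N gs)"
  have "continuous_map X (dual_topology Y N T) gs"
    using usc upper_semicontinuous_fst_assoc_multi_iff[OF T gs] by simp
  then have "continuous_map (prod_topology X Y) (prod_topology (dual_topology Y N T) Y)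
      (\<lambda>(x, y). (gs x, y))"
    by (simp add: continuous_map_prod_top)
  from equi_continuous_compose[OF this adm[unfolded EC_admissible_def]]
  show "equi_continuous (prod_topology X Y) g"
    \<comment> \<open>On the carrier of the product, \<open>g\<close> agrees with evaluation
      composed with \<open>(x, y) \<mapsto> (gs x, y)\<close>.\<close>
    by (rule equi_continuous_eq[rotated]) (use g in \<open>auto simp: associated_def\<close>)
qed

text \<open>The dual space itself serves as test space, which is why the type of test points is
  \<open>'y \<Rightarrow> 'z\<close>.\<close>

lemma EC_admissible_if_OZ_admissible:
  fixes N :: "('z::uniform_space \<times> 'z) set \<Rightarrow> ('y \<Rightarrow> 'z) \<Rightarrow> 'y \<Rightarrow> 'y set"
  assumes T: "topspace T = OZ Y N" and adm: "OZ_admissible TYPE('y \<Rightarrow> 'z) Y N T"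
  shows "EC_admissible Y (dual_topology Y N T)"
proof -
  let ?D = "dual_topology Y N T"
  have id: "(\<lambda>f. f) ` topspace ?D \<subseteq> EC Y"
    by (simp add: topspace_dual_topology[OF T])
  have "upper_semicontinuous_fst ?D T (assoc_multi Y N (\<lambda>f. f))"
    using upper_semicontinuous_fst_assoc_multi_iff[OF T id] by simp
  moreover have "associated ?D Y (\<lambda>(f, y). f y) (\<lambda>f. f)"
    by (simp add: associated_def)
  ultimately show ?thesis
    using adm id unfolding OZ_admissible_def EC_admissible_def by blast
qed

text \<open>Test spaces on \<open>'y \<Rightarrow> 'z\<close> already force admissibility of the
  dual, which in turn gives the condition for test spaces on an arbitrary type \<open>'x\<close>.
  Together the two conjuncts express the equivalence for all test spaces.\<close>

theorem theorem5p10: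
  fixes Y :: "'y topology"
    and N :: "('z::uniform_space \<times> 'z) set \<Rightarrow> ('y \<Rightarrow> 'z) \<Rightarrow> 'y \<Rightarrow> 'y set"
    and T :: "'y set topology"
  assumes "nbhd_choice Y N"
    and "topspace T = OZ Y N"
  shows "(OZ_admissible TYPE('y \<Rightarrow> 'z) Y N T \<longleftrightarrow> EC_admissible Y (dual_topology Y N T)) \<and>
         (EC_admissible Y (dual_topology Y N T) \<longrightarrow> OZ_admissible TYPE('x) Y N T)"
  by (intro conjI iffI impI)
    (erule EC_admissible_if_OZ_admissible[OF assms(2)] OZ_admissible_if_EC_admissible[OF assms(2)])+

end
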